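(* Let $(\Omega,\Sigma,\mathcal P)$ be a phantom probability space. Let $A_1,\dots,A_n\in\Sigma$ be disjoint events that form a partition of $\Omega$, and assume that for every $i=1,\dots,n$ the phantom number $\mathcal P(A_i)$ is nonzero and is not a zero divisor. Then for any event $B\in\Sigma$ such that $\mathcal P(B)$ is nonzero and not a zero divisor, and every $i$, $$\mathcal P(A_i\mid B)=\frac{\mathcal P(A_i)\,\mathcal P(B\mid A_i)}{\mathcal P(B)}=\frac{\mathcal P(A_i)\,\mathcal P(B\mid A_i)}{\mathcal P(A_1)\,\mathcal P(B\mid A_1)+\cdots+\mathcal P(A_n)\,\mathcal P(B\mid A_n)}.$$
   Context: The ring of phantom numbers $\mathbb{PH}$ is the set $\mathbb R\times\mathbb R$, with elements written $z=a+\wp b$ ($a=\operatorname{re}(z)$, $b=\operatorname{ph}(z)$), addition componentwise and multiplication $(a_1+\wp b_1)(a_2+\wp b_2)=a_1a_2+\wp(a_1b_2+b_1a_2+b_1b_2)$; its unit is $1=1+\wp0$. An element $z=a+\wp b$ is zero or a zero divisor iff $a=0$ or $a+b=0$; every other element has a unique multiplicative inverse $z^{-1}$, and $z_1/z_2:=z_1z_2^{-1}$ for $z_2$ nonzero and not a zero divisor. Let $\Sigma$ be a $\sigma$-algebra of subsets of a set $\Omega$. A phantom probability measure is a function $\mathcal P=\mathcal P_{\mathrm{re}}+\wp\,\mathcal P_{\mathrm{ph}}:\Sigma\to\mathbb{PH}$ ($\mathcal P_{\mathrm{re}},\mathcal P_{\mathrm{ph}}$ real valued) such that (i) $0\le\mathcal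 P_{\mathrm{re}}(A)\le1$ for all $A\in\Sigma$; (ii) $\mathcal P(\Omega)=1$; (iii) $\mathcal P(A\cup B)=\mathcal P(A)+\mathcal P(B)$ for disjoint $A,B\in\Sigma$; (iv) $-\mathcal P_{\mathrm{re}}(A)\le\mathcal P_{\mathrm{ph}}(A)\le1-\mathcal P_{\mathrm{re}}(A)$ for all $A\in\Sigma$. The triple $(\Omega,\Sigma,\mathcal P)$ is then a phantom probability space. For events $A,B$ with $\mathcal P(B)$ nonzero and not a zero divisor, the conditional phantom probability is $\mathcal P(A\mid B)=\mathcal P(A\cap B)/\mathcal P(B)$. *)

theory Defs
  imports "HOL-Analysis.Analysis"
begin

section \<open>The ring of phantom numbers\<close>

text \<open>\<open>PH a b\<close> stands for \<open>a + \<wp> b\<close>, where \<open>\<wp>\<^sup>2 = \<wp>\<close>.\<close>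

datatype phantom_num = PH (re: real) (ph: real)

instantiation phantom_num :: comm_ring_1
begin

definition "0 = PH 0 0"
definition "1 = PH 1 0"
definition "z + w = PH (re z + re w) (ph z + ph w)"
definition "- z = PH (- re z) (- ph z)"
definition "z - w = PH (re z - re w) (ph z - ph w)"
definition "z * w = PH (re z * re w) (re z * ph w + ph z * re w + ph z * ph w)"

instance
  by standard
    (simp_all add: zero_phantom_num_def one_phantom_num_def plus_phantom_num_def
      uminus_phantom_num_def minus_phantom_num_def times_phantom_num_def algebra_simps)

end

lemmas phantom_ring_defs =
  zero_phantom_num_def one_phantom_num_def plus_phantom_num_def uminus_phantom_num_def
  minus_phantom_num_def times_phantom_num_def

text \<open>In this definition \<open>0\<close> itself does not count as a zero divisor.\<close>

definition zero_divisor :: "'a::comm_ring \<Rightarrow> bool" where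
  "zero_divisor z \<longleftrightarrow> z \<noteq> 0 \<and> (\<exists>w. w \<noteq> 0 \<and> z * w = 0)"

lemma phantom_zero_or_zero_divisor_iff:
  "z = 0 \<or> zero_divisor z \<longleftrightarrow> re z = 0 \<or> re z + ph z = 0"
proof
  assume "z = 0 \<or> zero_divisor z"
  then show "re z = 0 \<or> re z + ph z = 0"
  proof
    assume "z = 0"
    then show ?thesis by (simp add: zero_phantom_num_def)
  next
    assume "zero_divisor z"
    then obtain w where w: "w \<noteq> 0" "z * w = 0" by (auto simp: zero_divisor_def)
    from w(2) have e: "re z * re w = 0" "re z * ph w + ph z * re w + ph z * ph w = 0"
      by (simp_all add: phantom_ring_defs)
    have "(re z + ph z) * (re w + ph w)
        = re z * re w + (re z * ph w + ph z * re w + ph z * ph w)"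
      by (simp add: algebra_simps)
    then have "(re z + ph z) * (re w + ph w) = 0" using e by simp
    moreover have "re w \<noteq> 0 \<or> re w + ph w \<noteq> 0"
      using w(1) by (cases w) (auto simp: zero_phantom_num_def)
    ultimately show ?thesis using e(1) by auto
  qed
next
  assume "re z = 0 \<or> re z + ph z = 0"
  then show "z = 0 \<or> zero_divisor z"
  proof
    assume "re z = 0"
    then have "z * PH 1 (-1) = 0" by (simp add: phantom_ring_defs)
    moreover have "PH 1 (-1) \<noteq> 0" by (simp add: zero_phantom_num_def)
    ultimately show ?thesis unfolding zero_divisor_def by blast
  next
    assume "re z + ph z = 0"
    then have "z * PH 0 1 = 0" by (simp add: phantom_ring_defs)
    moreover have "PH 0 1 \<noteq> 0" by (simp add: zero_phantom_num_def)
    ultimately show ?thesis unfolding zero_divisor_def by blast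
  qed
qed

lemma phantom_ex1_inverse:
  fixes z :: phantom_num
  assumes "z \<noteq> 0" "\<not> zero_divisor z"
  shows "\<exists>!w. z * w = 1"
proof -
  have nz: "re z \<noteq> 0" "re z + ph z \<noteq> 0"
    using assms phantom_zero_or_zero_divisor_iff by blast+
  define a c where "a = 1 / re z" and "c = 1 / (re z + ph z)"
  have a: "re z * a = 1" and c: "(re z + ph z) * c = 1"
    using nz by (simp_all add: a_def c_def)
  have "re z * (c - a) + ph z * a + ph z * (c - a) = (re z + ph z) * c - re z * a"
    by (simp add: algebra_simps)
  with a c have "re z * (c - a) + ph z * a + ph z * (c - a) = 0" by linarith
  with a have v: "z * PH a (c - a) = 1"
    by (simp only: times_phantom_num_def one_phantom_num_def phantom_num.sel)
  show ?thesis
  proof (rule ex1I, rule v)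
    fix w assume w: "z * w = 1"
    have "z * (w - PH a (c - a)) = 0"
      by (simp only: right_diff_distrib w v diff_self)
    with assms show "w = PH a (c - a)"
      unfolding zero_divisor_def by (metis eq_iff_diff_eq_0)
  qed
qed

text \<open>Inverse and division are made total by the usual convention that elements without an
  inverse are inverted to \<open>0\<close>.\<close>

instantiation phantom_num :: inverse
begin

definition "inverse z =
  (if z \<noteq> 0 \<and> \<not> zero_divisor z then THE w. z * w = 1 else (0::phantom_num))"

definition "z div w = z * inverse (w::phantom_num)"

instance ..

end

lemma phantom_right_inverse:
  fixes z :: phantom_num
  assumes "z \<noteq> 0" "\<not> zero_divisor z"
  shows "z * inverse z = 1"
  using theI'[OF phantom_ex1_inverse[OF assms]] assms by (simp add: inverse_phantom_num_def)


section \<open>Phantom probability spaces\<close>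

text \<open>Only finite additivity is required, although \<open>\<Sigma>\<close> is a \<open>\<sigma>\<close>-algebra.
  The values of \<open>P\<close> outside \<open>\<Sigma>\<close> are irrelevant.\<close>

locale phantom_prob_space = sigma_algebra \<Omega> \<Sigma>
  for \<Omega> :: "'a set" and \<Sigma> :: "'a set set" +
  fixes P :: "'a set \<Rightarrow> phantom_num"
  assumes re_bounds: "A \<in> \<Sigma> \<Longrightarrow> 0 \<le> re (P A) \<and> re (P A) \<le> 1"
    and total: "P \<Omega> = 1"
    and additive: "A \<in> \<Sigma> \<Longrightarrow> B \<in> \<Sigma> \<Longrightarrow> A \<inter> B = {} \<Longrightarrow> P (A \<union> B) = P A + P B"
    and ph_bounds: "A \<in> \<Sigma> \<Longrightarrow> - re (P A) \<le> ph (P A) \<and> ph (P A) \<le> 1 - re (P A)"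

definition cond_phantom_prob :: "('a set \<Rightarrow> phantom_num) \<Rightarrow> 'a set \<Rightarrow> 'a set \<Rightarrow> phantom_num" where
  "cond_phantom_prob P A B = P (A \<inter> B) / P B"

end

theory Submission
  imports Defs
begin

text \<open>As in the real case, Bayes' formula rests on the multiplication rule
  \<open>P A * P(B | A) = P (B \<inter> A)\<close> (lemma \<open>cond_phantom_prob_mult\<close>): it only
  multiplies by an inverse, so it holds over the phantom numbers as soon as \<open>P A\<close> is a unit.
  The rule turns the numerator into \<open>P (A i \<inter> B)\<close>, which gives the first equality by the
  definition of \<open>P(A i | B)\<close>. It turns the denominator into the sum of the
  \<open>P (B \<inter> A j)\<close>, and finite additivity over the partition makes that sum
  \<open>P B\<close> (lemma \<open>total_phantom_prob\<close>), which gives the second equality.\<close>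

lemma cond_phantom_prob_mult:
  assumes "P A \<noteq> 0" "\<not> zero_divisor (P A)"
  shows "P A * cond_phantom_prob P B A = P (B \<inter> A)"
proof -
  have "P A * cond_phantom_prob P B A = (P A * inverse (P A)) * P (B \<inter> A)"
    by (simp add: cond_phantom_prob_def divide_phantom_num_def mult_ac)
  then show ?thesis
    by (simp add: phantom_right_inverse assms)
qed

context phantom_prob_space
begin

lemma prob_empty: "P {} = 0"
  using additive[of "{}" "{}"] by simp

lemma finite_additive:
  assumes "finite I" "\<And>j. j \<in> I \<Longrightarrow> A j \<in> \<Sigma>" "disjoint_family_on A I"
  shows "P (\<Union>j\<in>I. A j) = (\<Sum>j\<in>I. P (A j))"
  using assms
proof (induction I rule: finite_induct)
  case empty
  show ?case by (simp add: prob_empty)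
next
  case (insert k I)
  have disj: "A k \<inter> (\<Union>j\<in>I. A j) = {}" and "disjoint_family_on A I"
    using insert.prems(2) insert.hyps(2) by (auto simp: disjoint_family_on_insert)
  then have IH: "P (\<Union>j\<in>I. A j) = (\<Sum>j\<in>I. P (A j))"
    using insert.IH insert.prems(1) by simp
  have "(\<Union>j\<in>I. A j) \<in> \<Sigma>"
    using insert.hyps(1) insert.prems(1) by (intro finite_UN) auto
  then have "P (A k \<union> (\<Union>j\<in>I. A j)) = P (A k) + P (\<Union>j\<in>I. A j)"
    using additive disj insert.prems(1) by simp
  then show ?case
    using insert.hyps IH by simp
qed

text \<open>The law of total probability: the pieces \<open>B \<inter> A j\<close> partition \<open>B\<close>, and the
  multiplication rule rewrites each summand as the probability of such a piece.\<close>

lemma total_phantom_prob: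
  assumes "finite I" and A: "\<And>j. j \<in> I \<Longrightarrow> A j \<in> \<Sigma>"
    and disj: "disjoint_family_on A I" and cover: "(\<Union>j\<in>I. A j) = \<Omega>"
    and unit: "\<And>j. j \<in> I \<Longrightarrow> P (A j) \<noteq> 0 \<and> \<not> zero_divisor (P (A j))"
    and B: "B \<in> \<Sigma>"
  shows "(\<Sum>j\<in>I. P (A j) * cond_phantom_prob P B (A j)) = P B"
proof -
  have "(\<Sum>j\<in>I. P (A j) * cond_phantom_prob P B (A j)) = (\<Sum>j\<in>I. P (B \<inter> A j))"
    using unit by (intro sum.cong) (simp_all add: cond_phantom_prob_mult)
  also have "\<dots> = P (\<Union>j\<in>I. B \<inter> A j)"
    using assms by (intro finite_additive[symmetric]) (auto simp: disjoint_family_on_def)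
  also have "(\<Union>j\<in>I. B \<inter> A j) = B"
    using cover sets_into_space[OF B] by blast
  finally show ?thesis .
qed

end

theorem theorem2p17:
  fixes \<Omega> :: "'a set" and \<Sigma> :: "'a set set" and P :: "'a set \<Rightarrow> phantom_num"
    and A :: "nat \<Rightarrow> 'a set" and B :: "'a set" and n i :: nat
  assumes "phantom_prob_space \<Omega> \<Sigma> P"
    and "\<And>j. j \<in> {1..n} \<Longrightarrow> A j \<in> \<Sigma>"
    and "disjoint_family_on A {1..n}"
    and "(\<Union>j\<in>{1..n}. A j) = \<Omega>"
    and "\<And>j. j \<in> {1..n} \<Longrightarrow> P (A j) \<noteq> 0 \<and> \<not> zero_divisor (P (A j))"
    and "B \<in> \<Sigma>"
    and "P B \<noteq> 0" and "\<not> zero_divisor (P B)"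
    and "i \<in> {1..n}"
  shows "cond_phantom_prob P (A i) B = P (A i) * cond_phantom_prob P B (A i) / P B
    \<and> P (A i) * cond_phantom_prob P B (A i) / P B
      = P (A i) * cond_phantom_prob P B (A i)
        / (\<Sum>j = 1..n. P (A j) * cond_phantom_prob P B (A j))"
proof -
  have "P (A i) * cond_phantom_prob P B (A i) = P (A i \<inter> B)"
    using assms(5,9) by (simp add: cond_phantom_prob_mult Int_commute)
  moreover have "(\<Sum>j = 1..n. P (A j) * cond_phantom_prob P B (A j)) = P B"
    using assms by (intro phantom_prob_space.total_phantom_prob) simp_all
  ultimately show ?thesis
    by (simp add: cond_phantom_prob_def)
qed

end
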